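(* Let $\mathcal{N}_{h}$ be a necklace with $h \geq 1$. If $h$ is odd, then $4 \leq \chi_{\mathrm{star}}'(\mathcal{N}_{h}) \leq 5$.
   Context: All graphs are simple, finite and undirected. For $h \geq 1$, the necklace $\mathcal{N}_h$ is the graph of order $2h+2$ with vertex set $\{0, 1, 2, \dots, h, h+1\} \cup \{1', 2', \dots, h'\}$ defined as follows. It is a Halin graph (a plane graph formed by a tree all of whose interior vertices have degree at least three together with a cycle through its leaves bounding the exterior face) whose characteristic tree is a caterpillar $T$ with spine the path $1, 2, \dots, h$ (edges $\{i,i+1\}$ for $1 \leq i \leq h-1$), and whose remaining tree edges are $\{0,1\}$, $\{h,h+1\}$ and $\{i,i'\}$ for $1 \leq i \leq h$. The remaining edges of $\mathcal{N}_h$ form the adjoint cycle of length $h+2$ with edges $\{0,1'\}, \{1',2'\}, \dots, \{(h-1)',h'\}, \{h',h+1\}, \{h+1,0\}$. A star $k$-edge-coloring of a graph $G$ is a proper edge-coloring of $G$ with $k$ colors such that no path of length four and no cycle of length four in $G$ (length = number of edges) is bicolored, i.e., at least three colors appear on every path or cycle of length four. The star chromatic index $\chi_{\mathrm{star}}'(G)$ is the smallest $k$ such that $G$ has a star $k$-edge-coloring. *)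

theory Defs
  imports Main
begin

text \<open>An undirected graph is a pair of a vertex set and a set of edges, each edge
  being the two-element set of its ends.\<close>

type_synonym 'a ugraph = "'a set \<times> 'a set set"

abbreviation verts :: "'a ugraph \<Rightarrow> 'a set" where "verts G \<equiv> fst G"
abbreviation edges :: "'a ugraph \<Rightarrow> 'a set set" where "edges G \<equiv> snd G"

definition finite_simple_graph :: "'a ugraph \<Rightarrow> bool" where
  "finite_simple_graph G \<longleftrightarrow>
     finite (verts G) \<and> (\<forall>e \<in> edges G. e \<subseteq> verts G \<and> card e = 2)"

definition path_edges :: "'a list \<Rightarrow> 'a set set" where
  "path_edges p = {{p ! i, p ! Suc i} | i. Suc i < length p}"

definition cycle_edges :: "'a list \<Rightarrow> 'a set set" where
  "cycle_edges p = insert {last p, hd p} (path_edges p)"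

text \<open>Paths and cycles are given by their lists of pairwise distinct vertices; their
  length is the number of edges, so a path of length n has n + 1 vertices and a
  cycle of length n has n vertices.\<close>

definition path_of_length :: "'a ugraph \<Rightarrow> nat \<Rightarrow> 'a list \<Rightarrow> bool" where
  "path_of_length G n p \<longleftrightarrow>
     length p = n + 1 \<and> distinct p \<and> set p \<subseteq> verts G \<and> path_edges p \<subseteq> edges G"

definition cycle_of_length :: "'a ugraph \<Rightarrow> nat \<Rightarrow> 'a list \<Rightarrow> bool" where
  "cycle_of_length G n p \<longleftrightarrow>
     n \<ge> 3 \<and> length p = n \<and> distinct p \<and> set p \<subseteq> verts G \<and> cycle_edges p \<subseteq> edges G"

text \<open>The colors are the numbers below k; not all of them have to be used.\<close>

definition proper_edge_coloring :: "'a ugraph \<Rightarrow> nat \<Rightarrow> ('a set \<Rightarrow> nat) \<Rightarrow> bool" where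
  "proper_edge_coloring G k c \<longleftrightarrow>
     c ` edges G \<subseteq> {..<k} \<and>
     (\<forall>e \<in> edges G. \<forall>f \<in> edges G. e \<noteq> f \<and> e \<inter> f \<noteq> {} \<longrightarrow> c e \<noteq> c f)"

definition star_edge_coloring :: "'a ugraph \<Rightarrow> nat \<Rightarrow> ('a set \<Rightarrow> nat) \<Rightarrow> bool" where
  "star_edge_coloring G k c \<longleftrightarrow>
     proper_edge_coloring G k c \<and>
     (\<forall>p. path_of_length G 4 p \<longrightarrow> card (c ` path_edges p) \<ge> 3) \<and>
     (\<forall>p. cycle_of_length G 4 p \<longrightarrow> card (c ` cycle_edges p) \<ge> 3)"

definition star_chromatic_index :: "'a ugraph \<Rightarrow> nat" where
  "star_chromatic_index G = (LEAST k. \<exists>c. star_edge_coloring G k c)"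

text \<open>In the necklace, \<open>Plain i\<close> stands for the vertex i (0 \<open>\<le>\<close> i \<open>\<le>\<close> h + 1) and
  \<open>Primed i\<close> for the vertex i' (1 \<open>\<le>\<close> i \<open>\<le>\<close> h).\<close>

datatype necklace_vertex = Plain nat | Primed nat

definition necklace_tree_edges :: "nat \<Rightarrow> necklace_vertex set set" where
  "necklace_tree_edges h =
     {{Plain i, Plain (i + 1)} | i. 1 \<le> i \<and> i + 1 \<le> h}
     \<union> {{Plain 0, Plain 1}, {Plain h, Plain (h + 1)}}
     \<union> {{Plain i, Primed i} | i. 1 \<le> i \<and> i \<le> h}"

definition necklace_cycle_edges :: "nat \<Rightarrow> necklace_vertex set set" where
  "necklace_cycle_edges h =
     {{Plain 0, Primed 1}}
     \<union> {{Primed i, Primed (i + 1)} | i. 1 \<le> i \<and> i + 1 \<le> h}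
     \<union> {{Primed h, Plain (h + 1)}, {Plain (h + 1), Plain 0}}"

definition necklace :: "nat \<Rightarrow> necklace_vertex ugraph" where
  "necklace h =
     (Plain ` {0..h + 1} \<union> Primed ` {1..h},
      necklace_tree_edges h \<union> necklace_cycle_edges h)"

lemma finite_simple_graph_necklace:
  assumes "h \<ge> 1"
  shows "finite_simple_graph (necklace h)"
  using assms
  by (auto simp: finite_simple_graph_def necklace_def necklace_tree_edges_def
      necklace_cycle_edges_def card_insert_if)

lemma card_verts_necklace: "card (verts (necklace h)) = 2 * h + 2"
proof -
  have "card (Plain ` {0..h + 1} \<union> Primed ` {1..h})
      = card (Plain ` {0..h + 1}) + card (Primed ` {1..h})"
    by (rule card_Un_disjoint) auto
  then show ?thesis
    by (simp add: necklace_def card_image inj_on_def)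
qed

end

theory Submission
  imports Defs
begin

text \<open>
  The necklace is a ladder whose two rails \<open>0, 1, ..., h, h + 1\<close> and \<open>0, 1', ..., h', h + 1\<close>
  share their ends, together with the rungs \<open>{i, i'}\<close> and one edge \<open>{0, h + 1}\<close> joining the
  two common ends.

  For the lower bound, suppose that three colors suffice. Every vertex has degree three, so it sees
  every color. The triangle \<open>0, 1, 1'\<close> uses all three colors, and each edge leaving it has
  the color of the opposite side. Hence the walk that enters the triangle along \<open>{h + 1, 0}\<close>,
  passes \<open>0, 1, 1'\<close> and leaves it is bicolored. It is a path of length four, or, if \<open>h = 1\<close>, a
  cycle of length four.

  For the upper bound, the rungs and \<open>{0, h + 1}\<close> form a perfect matching and get color 0. The
  other edges form a Hamiltonian cycle. The upper rail is colored 1, 3, 1, 4 periodically and the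
  lower rail 2, 4, 2, 3. Then the first and the third edge of a walk with three edges agree in
  color only when the color of the middle edge is larger
  (\<open>ladder_color_increases\<close>). In a walk with edge colors \<open>x, y, x, y\<close> this would give
  \<open>x < y < x\<close>; this is the argument of \<open>star_edge_coloringI\<close>. The parity of \<open>h\<close> matters at the
  vertex \<open>h + 1\<close>: the last edges of the two rails have odd index, so their colors are 3 and 4,
  while the first edges have the colors 1 and 2. So the walks through \<open>{0, h + 1}\<close> never repeat
  a color on its two sides.
\<close>

section \<open>A sufficient condition for star edge-colorings\<close>

lemma path_edges_5: "path_edges [a, b, c, d, e] = {{a, b}, {b, c}, {c, d}, {d, e}}"
proof -
  have "{i. Suc i < length [a, b, c, d, e]} = {0, 1, 2, 3}"
    by auto
  then have "path_edges [a, b, c, d, e]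
      = (\<lambda>i. {[a, b, c, d, e] ! i, [a, b, c, d, e] ! Suc i}) ` {0, 1, 2, 3}"
    unfolding path_edges_def by blast
  then show ?thesis
    by (simp add: eval_nat_numeral)
qed

lemma cycle_edges_4: "cycle_edges [a, b, c, d] = {{a, b}, {b, c}, {c, d}, {d, a}}"
proof -
  have "{i. Suc i < length [a, b, c, d]} = {0, 1, 2}"
    by auto
  then have "path_edges [a, b, c, d]
      = (\<lambda>i. {[a, b, c, d] ! i, [a, b, c, d] ! Suc i}) ` {0, 1, 2}"
    unfolding path_edges_def by blast
  then show ?thesis
    by (auto simp: cycle_edges_def eval_nat_numeral)
qed

lemma list_of_length_4: "length p = 4 \<Longrightarrow> \<exists>a b c d. p = [a, b, c, d]"
  by (auto simp: eval_nat_numeral length_Suc_conv)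

lemma list_of_length_5: "length p = 5 \<Longrightarrow> \<exists>a b c d e. p = [a, b, c, d, e]"
  by (auto simp: eval_nat_numeral length_Suc_conv)

lemma alternating_if_card_less_3:
  assumes "w \<noteq> x" "x \<noteq> y" "y \<noteq> z" and "card {w, x, y, z} < 3"
  shows "w = y \<and> x = z"
  using assms by (auto simp: card_insert_if split: if_splits)

text \<open>
  Paths and cycles of length four are treated at once as walks \<open>u, v, w, x, y\<close> without
  immediate reversals, with \<open>u = y\<close> for a cycle. Being bicolored means
  that such a walk is colored alternately, so that \<open>increases\<close> applies both to its first
  three and to its last three edges, with contradictory results.
\<close>

lemma star_edge_coloringI:
  assumes edges: "\<And>e. e \<in> edges G \<Longrightarrow> card e = 2"
    and bounded: "\<And>e. e \<in> edges G \<Longrightarrow> c e < k"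
    and proper: "\<And>u v w. {u, v} \<in> edges G \<Longrightarrow> {v, w} \<in> edges G \<Longrightarrow> u \<noteq> w \<Longrightarrow> c {u, v} \<noteq> c {v, w}"
    and increases: "\<And>u v w x. {u, v} \<in> edges G \<Longrightarrow> {v, w} \<in> edges G \<Longrightarrow> {w, x} \<in> edges G \<Longrightarrow>
      u \<noteq> w \<Longrightarrow> v \<noteq> x \<Longrightarrow> c {u, v} = c {w, x} \<Longrightarrow> c {u, v} < c {v, w}"
  shows "star_edge_coloring G k c"
proof -
  have walk: "card {c {u, v}, c {v, w}, c {w, x}, c {x, y}} \<ge> 3"
    if "{u, v} \<in> edges G" "{v, w} \<in> edges G" "{w, x} \<in> edges G" "{x, y} \<in> edges G"
      "u \<noteq> w" "v \<noteq> x" "w \<noteq> y" for u v w x y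
  proof (rule ccontr)
    assume "\<not> ?thesis"
    then have "c {u, v} = c {w, x} \<and> c {v, w} = c {x, y}"
      by (intro alternating_if_card_less_3) (use that proper in auto)
    with increases[of u v w x] increases[of v w x y] that show False
      by simp
  qed
  have "proper_edge_coloring G k c"
    unfolding proper_edge_coloring_def
  proof (intro conjI ballI impI)
    fix e f assume ef: "e \<in> edges G" "f \<in> edges G" "e \<noteq> f \<and> e \<inter> f \<noteq> {}"
    then obtain v where v: "v \<in> e" "v \<in> f" by blast
    obtain u where u: "e = {u, v}"
      using edges[OF ef(1)] v(1) by (auto simp: card_2_iff)
    obtain w where w: "f = {v, w}"
      using edges[OF ef(2)] v(2) by (auto simp: card_2_iff)
    show "c e \<noteq> c f"
      using proper[of u v w] ef u w by auto
  qed (use bounded in auto)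
  moreover have "card (c ` path_edges p) \<ge> 3" if "path_of_length G 4 p" for p
  proof -
    from that have "length p = 5"
      by (simp add: path_of_length_def)
    then obtain u v w x y where "p = [u, v, w, x, y]"
      using list_of_length_5[of p] by blast
    with that walk[of u v w x y] show ?thesis
      by (auto simp: path_of_length_def path_edges_5)
  qed
  moreover have "card (c ` cycle_edges p) \<ge> 3" if "cycle_of_length G 4 p" for p
  proof -
    from that have "length p = 4"
      by (simp add: cycle_of_length_def)
    then obtain u v w x where "p = [u, v, w, x]"
      using list_of_length_4[of p] by blast
    with that walk[of u v w x u] show ?thesis
      by (auto simp: cycle_of_length_def cycle_edges_4)
  qed
  ultimately show ?thesis
    by (simp add: star_edge_coloring_def)
qed

section \<open>The necklace as a ladder\<close>

text \<open>
  The flag selects the upper or the lower rail. The two rails share their ends, so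
  \<open>spot h True\<close> and \<open>spot h False\<close> agree at \<open>0\<close> and \<open>h + 1\<close>; with this convention the
  first and the last edge of a rail have the same form as its other edges.
\<close>

definition spot :: "nat \<Rightarrow> bool \<Rightarrow> nat \<Rightarrow> necklace_vertex" where
  "spot h s i = (if s \<or> i = 0 \<or> i = Suc h then Plain i else Primed i)"

lemma spot_eq_iff: "spot h s i = spot h t j \<longleftrightarrow> i = j \<and> (s = t \<or> i = 0 \<or> i = Suc h)"
  by (auto simp: spot_def)

lemma necklace_edge_cases:
  assumes "h \<ge> 1" "e \<in> edges (necklace h)"
  obtains (rail) s i where "i \<le> h" "e = {spot h s i, spot h s (Suc i)}"
  | (rung) i where "1 \<le> i" "i \<le> h" "e = {spot h True i, spot h False i}"
  | (closing) "e = {spot h True 0, spot h True (Suc h)}"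
proof -
  consider i where "1 \<le> i" "i + 1 \<le> h" "e = {Plain i, Plain (i + 1)}"
    | "e = {Plain 0, Plain 1}" | "e = {Plain h, Plain (h + 1)}"
    | i where "1 \<le> i" "i \<le> h" "e = {Plain i, Primed i}"
    | "e = {Plain 0, Primed 1}"
    | i where "1 \<le> i" "i + 1 \<le> h" "e = {Primed i, Primed (i + 1)}"
    | "e = {Primed h, Plain (h + 1)}" | "e = {Plain (h + 1), Plain 0}"
    using assms(2)
    unfolding necklace_def necklace_tree_edges_def necklace_cycle_edges_def snd_conv
      Un_iff insert_iff empty_iff mem_Collect_eq
    by - (elim disjE exE conjE FalseE; (rule that; assumption))
  then show thesis
  proof cases
    case (1 i) then show ?thesis by (intro rail[of i True]) (auto simp: spot_def)
  next
    case 2 then show ?thesis by (intro rail[of 0 True]) (auto simp: spot_def)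
  next
    case 3 then show ?thesis by (intro rail[of h True]) (auto simp: spot_def)
  next
    case 4 then show ?thesis by (intro rung) (auto simp: spot_def)
  next
    case 5 with assms(1) show ?thesis by (intro rail[of 0 False]) (auto simp: spot_def)
  next
    case (6 i) then show ?thesis by (intro rail[of i False]) (auto simp: spot_def)
  next
    case 7 with assms(1) show ?thesis by (intro rail[of h False]) (auto simp: spot_def)
  next
    case 8 then show ?thesis by (intro closing) (auto simp: spot_def)
  qed
qed

section \<open>At least four colors\<close>

lemma third_color:
  fixes x y z u :: nat
  assumes "x < 3" "y < 3" "z < 3" "u < 3" and "x \<noteq> y" "x \<noteq> z" "y \<noteq> z" and "u \<noteq> x" "u \<noteq> y"
  shows "u = z"
proof -
  have "t = 0 \<or> t = 1 \<or> t = 2" if "t < 3" for t :: nat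
    using that by auto
  from this[of x] this[of y] this[of z] this[of u] assms show ?thesis
    by metis
qed

text \<open>
  The vertex at which a walk through the triangle \<open>0, 1, 1'\<close> ends after leaving it at \<open>1'\<close> is
  \<open>2'\<close> in general, but it is \<open>2 = h + 1\<close> if \<open>h = 1\<close>. In that case the bicolored walk closes up
  to a cycle, so the condition on cycles gives the contradiction there.
\<close>

lemma star_edge_coloring_necklace_ge_4:
  assumes h: "h \<ge> 1" and star: "star_edge_coloring (necklace h) k c"
  shows "k \<ge> 4"
proof (rule ccontr)
  assume "\<not> k \<ge> 4"
  define w where "w = (if h = 1 then Plain 2 else Primed 2)"
  have proper: "c e \<noteq> c f"
    if "e \<in> edges (necklace h)" "f \<in> edges (necklace h)" "e \<noteq> f" "e \<inter> f \<noteq> {}" for e f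
    using star that by (auto simp: star_edge_coloring_def proper_edge_coloring_def)
  have three: "c e < 3" if "e \<in> edges (necklace h)" for e
    using star that \<open>\<not> k \<ge> 4\<close>
    by (fastforce simp: star_edge_coloring_def proper_edge_coloring_def)
  have e: "{Plain (Suc h), Plain 0} \<in> edges (necklace h)" "{Plain 0, Plain 1} \<in> edges (necklace h)"
    "{Plain 0, Primed 1} \<in> edges (necklace h)"
    by (simp_all add: necklace_def necklace_tree_edges_def necklace_cycle_edges_def)
  have rung: "{Plain 1, Primed 1} \<in> edges (necklace h)"
    unfolding necklace_def necklace_tree_edges_def snd_conv using h by blast
  have leaving: "{Primed 1, w} \<in> edges (necklace h)"
  proof (cases "h = 1")
    case True
    then show ?thesis
      by (simp add: w_def necklace_def necklace_cycle_edges_def numeral_2_eq_2)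
  next
    case False
    then have "w = Primed (1 + 1)" "1 + 1 \<le> h"
      using h by (simp_all add: w_def)
    then show ?thesis
      unfolding necklace_def necklace_cycle_edges_def snd_conv by blast
  qed
  note e = e rung leaving
  have w: "w \<noteq> Plain 0" "w \<noteq> Plain 1" "w \<noteq> Primed 1"
    by (simp_all add: w_def)
  have neq: "c {Plain 0, Plain 1} \<noteq> c {Plain 0, Primed 1}"
    "c {Plain 0, Plain 1} \<noteq> c {Plain 1, Primed 1}"
    "c {Plain 0, Primed 1} \<noteq> c {Plain 1, Primed 1}"
    "c {Plain (Suc h), Plain 0} \<noteq> c {Plain 0, Plain 1}"
    "c {Plain (Suc h), Plain 0} \<noteq> c {Plain 0, Primed 1}"
    "c {Primed 1, w} \<noteq> c {Plain 0, Primed 1}"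
    "c {Primed 1, w} \<noteq> c {Plain 1, Primed 1}"
    using e h w by (simp_all add: proper doubleton_eq_iff)
  have 1: "c {Plain (Suc h), Plain 0} = c {Plain 1, Primed 1}"
    by (rule third_color[OF three three three three neq(1) neq(2) neq(3) neq(4) neq(5)]; fact e)
  have 2: "c {Primed 1, w} = c {Plain 0, Plain 1}"
    by (rule third_color[OF three three three three neq(3) neq(1)[symmetric] neq(2)[symmetric]
          neq(6) neq(7)]; fact e)
  show False
  proof (cases "h = 1")
    case True
    then have w: "w = Plain (Suc h)"
      by (simp add: w_def)
    let ?p = "[Plain (Suc h), Plain 0, Plain 1, Primed 1]"
    have "cycle_of_length (necklace h) 4 ?p"
      using e True unfolding cycle_of_length_def cycle_edges_4 w
      by (auto simp: necklace_def)
    then have "card (c ` cycle_edges ?p) \<ge> 3"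
      using star by (auto simp: star_edge_coloring_def)
    moreover have "c ` cycle_edges ?p = {c {Plain 0, Plain 1}, c {Plain 1, Primed 1}}"
      unfolding cycle_edges_4 using 1 2 w by auto
    ultimately show False
      by (auto simp: card_insert_if split: if_splits)
  next
    case False
    then have w: "w = Primed 2"
      by (simp add: w_def)
    let ?p = "[Plain (Suc h), Plain 0, Plain 1, Primed 1, w]"
    have "path_of_length (necklace h) 4 ?p"
      using e h False unfolding path_of_length_def path_edges_5 w
      by (auto simp: necklace_def)
    then have "card (c ` path_edges ?p) \<ge> 3"
      using star by (auto simp: star_edge_coloring_def)
    moreover have "c ` path_edges ?p = {c {Plain 0, Plain 1}, c {Plain 1, Primed 1}}"
      unfolding path_edges_5 using 1 2 by auto
    ultimately show False
      by (auto simp: card_insert_if split: if_splits)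
  qed
qed

section \<open>A star edge-coloring with five colors\<close>

text \<open>
  The color of the edge from position \<open>i\<close> to position \<open>i + 1\<close>. The flag selects the upper rail,
  with colors 1, 3, 1, 4, or the lower rail, with colors 2, 4, 2, 3. The upper and lower colors at
  indices that differ by at most one are always different, so no rail color occurs at both ends
  of a rung.
\<close>

definition rail_color :: "bool \<Rightarrow> nat \<Rightarrow> nat" where
  "rail_color upper i =
     (if even i then (if upper then 1 else 2) else (if upper = even (i div 2) then 3 else 4))"

lemma rail_color_pos: "rail_color s i > 0"
  by (simp add: rail_color_def)

lemma rail_color_parity: "even i \<noteq> even j \<Longrightarrow> rail_color s i \<noteq> rail_color s' j"
  by (auto simp: rail_color_def)

lemma rail_color_opposite: "rail_color s i = rail_color t i \<longleftrightarrow> s = t"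
  by (auto simp: rail_color_def)

lemma rail_color_distance_2:
  "rail_color s i = rail_color s (Suc (Suc i)) \<longleftrightarrow> even i"
  "rail_color s (Suc (Suc i)) = rail_color s i \<longleftrightarrow> even i"
  by (auto simp: rail_color_def)

lemma rail_color_even_less_odd: "even i \<Longrightarrow> odd j \<Longrightarrow> rail_color s i < rail_color t j"
  by (simp add: rail_color_def)

fun position :: "necklace_vertex \<Rightarrow> nat" where
  "position (Plain i) = i"
| "position (Primed i) = i"

text \<open>
  The rails consist of the edges between consecutive positions, since \<open>0\<close> and \<open>h + 1\<close> are not
  consecutive for \<open>h \<ge> 1\<close>. Having only unprimed ends distinguishes the upper rail, because every
  edge of the lower rail has a primed end.
\<close>

definition ladder_color :: "necklace_vertex set \<Rightarrow> nat" where
  "ladder_color e =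
     (let i = Min (position ` e)
      in if Max (position ` e) = Suc i then rail_color (e \<subseteq> range Plain) i else 0)"

lemma ladder_color_rail:
  assumes "h \<ge> 1" "i \<le> h"
  shows "ladder_color {spot h s i, spot h s (Suc i)} = rail_color s i"
proof -
  have "{spot h s i, spot h s (Suc i)} \<subseteq> range Plain \<longleftrightarrow> s"
    using assms by (auto simp: spot_def image_iff)
  moreover have "position (spot h s j) = j" for j
    by (simp add: spot_def)
  ultimately show ?thesis
    by (simp add: ladder_color_def)
qed

lemma ladder_color_rung: "ladder_color {spot h s i, spot h t i} = 0"
  by (auto simp: ladder_color_def spot_def)

lemma ladder_color_closing: "h \<ge> 1 \<Longrightarrow> ladder_color {spot h s 0, spot h t (Suc h)} = 0"
  by (auto simp: ladder_color_def spot_def)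

lemma ladder_color_less_5: "ladder_color e < 5"
  by (simp add: ladder_color_def Let_def rail_color_def)

text \<open>
  Oriented edges, so that a walk becomes a sequence of such steps. Rungs are listed in both
  directions instead of with a negated flag: this keeps the flags in case distinctions concrete.
\<close>

lemma ladder_step:
  assumes "h \<ge> 1" "{u, v} \<in> edges (necklace h)"
  obtains (forward) s i where "i \<le> h" "u = spot h s i" "v = spot h s (Suc i)"
      "ladder_color {u, v} = rail_color s i"
  | (backward) s i where "i \<le> h" "u = spot h s (Suc i)" "v = spot h s i"
      "ladder_color {u, v} = rail_color s i"
  | (down) i where "1 \<le> i" "i \<le> h" "u = spot h True i" "v = spot h False i"
      "ladder_color {u, v} = 0"
  | (up) i where "1 \<le> i" "i \<le> h" "u = spot h False i" "v = spot h True i"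
      "ladder_color {u, v} = 0"
  | (closing) "u = spot h True 0" "v = spot h True (Suc h)" "ladder_color {u, v} = 0"
  | (closing_back) "u = spot h True (Suc h)" "v = spot h True 0" "ladder_color {u, v} = 0"
  using assms
proof (cases rule: necklace_edge_cases)
  case (rail s i)
  with ladder_color_rail[OF assms(1), of i s] show ?thesis
    using forward[of i s] backward[of i s] by (auto simp: doubleton_eq_iff insert_commute)
next
  case (rung i)
  with ladder_color_rung[of h True i False] show ?thesis
    using down[of i] up[of i] by (auto simp: doubleton_eq_iff insert_commute)
next
  case closing
  with ladder_color_closing[OF assms(1), of True True] show ?thesis
    using that(5,6) by (auto simp: doubleton_eq_iff insert_commute)
qed

lemma ladder_color_proper:
  assumes "h \<ge> 1" "odd h" and "{u, v} \<in> edges (necklace h)" "{v, w} \<in> edges (necklace h)" "u \<noteq> w"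
  shows "ladder_color {u, v} \<noteq> ladder_color {v, w}"
  using assms(1,3)
proof (cases rule: ladder_step)
  case forward
  show ?thesis
    using assms(1,4)
    by (cases rule: ladder_step; use forward assms(2,5) in
      \<open>auto simp: spot_eq_iff rail_color_pos rail_color_parity rail_color_opposite\<close>)
next
  case backward
  show ?thesis
    using assms(1,4)
    by (cases rule: ladder_step; use backward assms(2,5) in
      \<open>auto simp: spot_eq_iff rail_color_pos rail_color_parity rail_color_opposite\<close>)
next
  case down
  show ?thesis
    using assms(1,4)
    by (cases rule: ladder_step; use down assms(2,5) in
      \<open>auto simp: spot_eq_iff rail_color_pos rail_color_parity rail_color_opposite\<close>)
next
  case up
  show ?thesis
    using assms(1,4)
    by (cases rule: ladder_step; use up assms(2,5) in
      \<open>auto simp: spot_eq_iff rail_color_pos rail_color_parity rail_color_opposite\<close>)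
next
  case closing
  show ?thesis
    using assms(1,4)
    by (cases rule: ladder_step; use closing assms(2,5) in
      \<open>auto simp: spot_eq_iff rail_color_pos rail_color_parity rail_color_opposite\<close>)
next
  case closing_back
  show ?thesis
    using assms(1,4)
    by (cases rule: ladder_step; use closing_back assms(2,5) in
      \<open>auto simp: spot_eq_iff rail_color_pos rail_color_parity rail_color_opposite\<close>)
qed

text \<open>
  The middle edge cannot have color 0, since no color of rail edges occurs at both ends of a rung
  or at both ends of \<open>{0, h + 1}\<close>. If the color 0 is repeated, the middle edge lies on a rail and
  its color is positive. On the Hamiltonian cycle formed by the rails, edges of color
  3 or 4 with exactly one edge between them have different colors, so a color repeated there is
  1 or 2 and the edge between has color 3 or 4.
\<close>

lemma ladder_color_increases:
  assumes "h \<ge> 1" "odd h"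
    and "{u, v} \<in> edges (necklace h)" "{v, w} \<in> edges (necklace h)" "{w, x} \<in> edges (necklace h)"
    and "u \<noteq> w" "v \<noteq> x" and "ladder_color {u, v} = ladder_color {w, x}"
  shows "ladder_color {u, v} < ladder_color {v, w}"
  using assms(1,4)
proof (cases rule: ladder_step)
  case forward
  show ?thesis
    by (cases rule: ladder_step[OF assms(1,3)]; cases rule: ladder_step[OF assms(1,5)];
      use forward assms(2,6-8) in
        \<open>auto simp: spot_eq_iff rail_color_pos rail_color_parity rail_color_opposite
          rail_color_distance_2 rail_color_even_less_odd\<close>)
next
  case backward
  show ?thesis
    by (cases rule: ladder_step[OF assms(1,3)]; cases rule: ladder_step[OF assms(1,5)];
      use backward assms(2,6-8) in
        \<open>auto simp: spot_eq_iff rail_color_pos rail_color_parity rail_color_opposite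
          rail_color_distance_2 rail_color_even_less_odd\<close>)
next
  case down
  show ?thesis
    by (cases rule: ladder_step[OF assms(1,3)]; cases rule: ladder_step[OF assms(1,5)];
      use down assms(2,6-8) in
        \<open>auto simp: spot_eq_iff rail_color_pos rail_color_parity rail_color_opposite
          rail_color_distance_2 rail_color_even_less_odd\<close>)
next
  case up
  show ?thesis
    by (cases rule: ladder_step[OF assms(1,3)]; cases rule: ladder_step[OF assms(1,5)];
      use up assms(2,6-8) in
        \<open>auto simp: spot_eq_iff rail_color_pos rail_color_parity rail_color_opposite
          rail_color_distance_2 rail_color_even_less_odd\<close>)
next
  case closing
  show ?thesis
    by (cases rule: ladder_step[OF assms(1,3)]; cases rule: ladder_step[OF assms(1,5)];
      use closing assms(2,6-8) in
        \<open>auto simp: spot_eq_iff rail_color_pos rail_color_parity rail_color_opposite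
          rail_color_distance_2 rail_color_even_less_odd\<close>)
next
  case closing_back
  show ?thesis
    by (cases rule: ladder_step[OF assms(1,3)]; cases rule: ladder_step[OF assms(1,5)];
      use closing_back assms(2,6-8) in
        \<open>auto simp: spot_eq_iff rail_color_pos rail_color_parity rail_color_opposite
          rail_color_distance_2 rail_color_even_less_odd\<close>)
qed

lemma star_edge_coloring_ladder_color:
  assumes "h \<ge> 1" "odd h"
  shows "star_edge_coloring (necklace h) 5 ladder_color"
proof (rule star_edge_coloringI)
  show "card e = 2" if "e \<in> edges (necklace h)" for e
    using finite_simple_graph_necklace[OF assms(1)] that by (auto simp: finite_simple_graph_def)
qed (rule ladder_color_less_5 ladder_color_proper[OF assms] ladder_color_increases[OF assms];
    assumption)+

section \<open>The star chromatic index\<close>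

theorem theorem2p2:
  fixes h :: nat
  assumes "h \<ge> 1" and "odd h"
  shows "4 \<le> star_chromatic_index (necklace h) \<and> star_chromatic_index (necklace h) \<le> 5"
proof
  have coloring: "\<exists>c. star_edge_coloring (necklace h) 5 c"
    using star_edge_coloring_ladder_color[OF assms] by blast
  then have "\<exists>c. star_edge_coloring (necklace h) (star_chromatic_index (necklace h)) c"
    unfolding star_chromatic_index_def by (rule LeastI)
  then show "4 \<le> star_chromatic_index (necklace h)"
    using star_edge_coloring_necklace_ge_4[OF assms(1)] by blast
  show "star_chromatic_index (necklace h) \<le> 5"
    unfolding star_chromatic_index_def using coloring by (rule Least_le)
qed

end
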